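(* For all $n\ge 2$ and all nonnegative integers $x_1,\dots,x_n$, $$x_1+(x_2\oplus x_3\oplus\cdots\oplus x_n)\le \mathcal{N}(x_1,x_2,\dots,x_n)\le x_1+x_2+\cdots+x_n .$$
   Context: For nonnegative integers, $\oplus$ denotes bitwise xor. For nonnegative integers $x_1,\dots,x_n$ ($n\ge 2$), the Auxiliary Nim position $(x_1,x_2,\dots,x_n)$, i.e. the selective compound of the Nim heap $*x_1$ with the disjunctive sum of the Nim heaps $*x_2,\dots,*x_n$, is the impartial game (normal play) in which a move consists of one of the following: strictly decrease $x_1$ only; strictly decrease exactly one of $x_2,\dots,x_n$ only; or do both simultaneously (strictly decrease $x_1$ and strictly decrease exactly one of $x_2,\dots,x_n$). All heap sizes stay nonnegative integers. $\mathcal{N}(x_1,\dots,x_n)$ denotes the Sprague-Grundy value: $0$ at terminal positions, and otherwise the minimum nonnegative integer not occurring among the Sprague-Grundy values of the positions reachable in one move. *)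

theory Defs
  imports Main
begin

definition nim_move :: "nat list \<Rightarrow> nat list \<Rightarrow> bool" where
  "nim_move ys ys' \<longleftrightarrow> (\<exists>i < length ys. \<exists>k < ys ! i. ys' = ys[i := k])"

(* A position (x1, ..., xn) is the list of its heap sizes: its head is the single heap x1,
   its tail is the disjunctive sum of the heaps x2, ..., xn. *)

inductive aux_nim_move :: "nat list \<Rightarrow> nat list \<Rightarrow> bool" where
  first: "x' < x \<Longrightarrow> aux_nim_move (x # ys) (x' # ys)"
| rest: "nim_move ys ys' \<Longrightarrow> aux_nim_move (x # ys) (x # ys')"
| both: "x' < x \<Longrightarrow> nim_move ys ys' \<Longrightarrow> aux_nim_move (x # ys) (x' # ys')"

definition mex :: "nat set \<Rightarrow> nat" where
  "mex S = (LEAST m. m \<notin> S)"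

lemma nim_move_sum_list_less:
  assumes "nim_move ys ys'"
  shows "sum_list ys' < sum_list ys"
proof -
  obtain i k where i: "i < length ys" and k: "k < ys ! i" and ys': "ys' = ys[i := k]"
    using assms by (auto simp: nim_move_def)
  have "ys ! i \<le> sum_list ys"
    using i by (rule elem_le_sum_list)
  then show ?thesis
    using i k by (simp add: ys' sum_list_update)
qed

lemma aux_nim_move_sum_list_less:
  "aux_nim_move xs ys \<Longrightarrow> sum_list ys < sum_list xs"
  by (induction rule: aux_nim_move.induct)
    (auto dest: nim_move_sum_list_less)

(* Terminal positions need no separate clause: see mex_empty. *)

function grundy :: "nat list \<Rightarrow> nat" where
  "grundy xs = mex (grundy ` {ys. aux_nim_move xs ys})"
  by pat_completeness auto
termination
  by (relation "measure sum_list") (auto dest: aux_nim_move_sum_list_less)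

declare grundy.simps [simp del]

lemma mex_empty: "mex {} = 0"
  by (simp add: mex_def)

lemma finite_nim_moves: "finite {ys'. nim_move ys ys'}"
proof -
  have "{ys'. nim_move ys ys'} = (\<Union>i<length ys. (\<lambda>k. ys[i := k]) ` {..<ys ! i})"
    by (auto simp: nim_move_def)
  then show ?thesis by simp
qed

(* Finiteness ensures that the minimum defining mex exists. *)

lemma finite_aux_nim_moves: "finite {ys. aux_nim_move xs ys}"
proof (cases xs)
  case Nil
  then have "{ys. aux_nim_move xs ys} = {}"
    by (auto elim: aux_nim_move.cases)
  then show ?thesis by simp
next
  case (Cons x zs)
  have "{ys. aux_nim_move xs ys} \<subseteq>
      (\<lambda>(a, bs). a # bs) ` ({..x} \<times> insert zs {zs'. nim_move zs zs'})"
    by (auto simp: Cons elim!: aux_nim_move.cases)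
  then show ?thesis
    by (rule finite_subset) (simp add: finite_nim_moves)
qed

definition xor_list :: "nat list \<Rightarrow> nat" where
  "xor_list ys = foldr Bit_Operations.xor ys 0"

end

theory Submission
  imports Defs
begin

text \<open>
  Write a position as \<open>x # ys\<close>. Every option of \<open>x' # ys\<close> with \<open>x' < x\<close> is also an option of
  \<open>x # ys\<close>, and so is \<open>x' # ys\<close> itself. Hence the Grundy value strictly increases with the
  single heap (lemma \<open>grundy_strict_mono_single_heap\<close>), and it is at least \<open>x\<close> more than the value
  of \<open>0 # ys\<close>. With the single heap empty the game is ordinary Nim on \<open>ys\<close>, so that value is the
  xor of the heaps by Bouton's theorem (lemma \<open>grundy_0_Cons\<close>). This gives the lower bound.

  The upper bound holds because every move decreases the total number of tokens: by induction the
  values of the options lie below that total, so the total bounds their minimal excludant.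
\<close>

lemma mex_notin: "finite S \<Longrightarrow> mex S \<notin> S"
  unfolding mex_def by (metis LeastI ex_new_if_finite infinite_UNIV_nat)

lemma mex_le: "m \<notin> S \<Longrightarrow> mex S \<le> m"
  unfolding mex_def by (rule Least_le)

lemma less_mex_mem: "m < mex S \<Longrightarrow> m \<in> S"
  using mex_le by (metis not_less)

lemma grundy_option_neq: "aux_nim_move xs ys \<Longrightarrow> grundy ys \<noteq> grundy xs"
  using mex_notin[of "grundy ` {ys. aux_nim_move xs ys}"]
  unfolding grundy.simps[of xs] by (metis finite_aux_nim_moves finite_imageI imageI mem_Collect_eq)

lemma less_grundyE:
  assumes "m < grundy xs"
  obtains ys where "aux_nim_move xs ys" "grundy ys = m"
  using less_mex_mem[of m "grundy ` {ys. aux_nim_move xs ys}"] assms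
  by (auto simp: grundy.simps[of xs])

lemma grundy_le:
  assumes "\<And>ys. aux_nim_move xs ys \<Longrightarrow> grundy ys \<noteq> m"
  shows "grundy xs \<le> m"
  unfolding grundy.simps[of xs] using assms by (intro mex_le) auto

lemma grundy_le_sum_list: "grundy xs \<le> sum_list xs"
proof (induction xs rule: measure_induct_rule[of sum_list])
  case (less xs)
  show ?case
    using less aux_nim_move_sum_list_less by (intro grundy_le) fastforce
qed

lemma aux_nim_move_enlarge_single_heap:
  assumes "aux_nim_move (x' # ys) zs" "x' < x"
  shows "aux_nim_move (x # ys) zs"
  using assms by (cases rule: aux_nim_move.cases) (auto intro: aux_nim_move.intros)

text \<open>
  If the value of \<open>x # ys\<close> were at most that of its option \<open>x' # ys\<close>, it would be attained by
  \<open>x' # ys\<close> or by one of its options, all of which are options of \<open>x # ys\<close>.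
\<close>

lemma grundy_strict_mono_single_heap:
  assumes "x' < x"
  shows "grundy (x' # ys) < grundy (x # ys)"
proof (rule ccontr)
  assume "\<not> ?thesis"
  moreover have "grundy (x' # ys) \<noteq> grundy (x # ys)"
    using assms by (intro grundy_option_neq first)
  ultimately have "grundy (x # ys) < grundy (x' # ys)"
    by simp
  then obtain zs where "aux_nim_move (x' # ys) zs" "grundy zs = grundy (x # ys)"
    by (rule less_grundyE)
  then show False
    using assms aux_nim_move_enlarge_single_heap grundy_option_neq by blast
qed

lemma grundy_Cons_ge: "x + grundy (0 # ys) \<le> grundy (x # ys)"
proof (induction x)
  case (Suc x)
  then show ?case
    using grundy_strict_mono_single_heap[of x "Suc x" ys] by simp
qed simp

lemma nat_less_iff_half:
  fixes m n :: nat
  shows "m < n \<longleftrightarrow> m div 2 < n div 2 \<or> m div 2 = n div 2 \<and> even m \<and> odd n"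
  by presburger

lemma xor_div_2: "Bit_Operations.xor m n div 2 = Bit_Operations.xor (m div 2) (n div 2)" for m n :: nat
  using drop_bit_xor[of 1 m n] unfolding One_nat_def drop_bit_Suc drop_bit_0 id_apply .

text \<open>
  This provides the move from two Nim heaps \<open>a\<close> and \<open>b\<close> to a position of value \<open>m\<close>. The numbers
  are compared by their halves and, where these agree, by their last binary digits: if only the
  last digit makes \<open>m\<close> smaller than the xor of \<open>a\<close> and \<open>b\<close>, then exactly one of \<open>a\<close> and \<open>b\<close> is
  odd, and clearing its last digit is the move.
\<close>

lemma less_xor_nat_cases:
  fixes a b m :: nat
  assumes "m < Bit_Operations.xor a b"
  shows "Bit_Operations.xor m b < a \<or> Bit_Operations.xor m a < b"
  using assms
proof (induction "a + b" arbitrary: a b m rule: less_induct)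
  case less
  show ?case
  proof (cases "m div 2 < Bit_Operations.xor (a div 2) (b div 2)")
    case True
    have "Bit_Operations.xor (m div 2) (b div 2) < a div 2
        \<or> Bit_Operations.xor (m div 2) (a div 2) < b div 2"
    proof (rule less.hyps[OF _ True])
      have "a \<noteq> 0 \<or> b \<noteq> 0"
        using True by auto
      then show "a div 2 + b div 2 < a + b"
        by linarith
    qed
    then show ?thesis
      unfolding xor_div_2[symmetric]
      using nat_less_iff_half[of _ a] nat_less_iff_half[of _ b] by blast
  next
    case False
    have half: "m div 2 = Bit_Operations.xor (a div 2) (b div 2)"
      and parity: "even m" "odd a \<noteq> odd b"
      using less.prems False nat_less_iff_half[of m "Bit_Operations.xor a b"] even_xor_iff[of a b]
      unfolding xor_div_2 by blast+
    show ?thesis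
    proof (cases "odd a")
      case True
      have "Bit_Operations.xor m b div 2 = a div 2"
        by (simp add: xor_div_2 half xor.assoc)
      with True parity have "Bit_Operations.xor m b < a"
        using nat_less_iff_half[of "Bit_Operations.xor m b" a] even_xor_iff[of m b] by blast
      then show ?thesis ..
    next
      case False
      have "Bit_Operations.xor m a div 2 = b div 2"
        by (simp add: xor_div_2 half xor.commute[of "a div 2" "b div 2"] xor.assoc)
      with False parity have "Bit_Operations.xor m a < b"
        using nat_less_iff_half[of "Bit_Operations.xor m a" b] even_xor_iff[of m a] by blast
      then show ?thesis ..
    qed
  qed
qed

lemma xor_list_simps:
  "xor_list [] = 0"
  "xor_list (y # ys) = Bit_Operations.xor y (xor_list ys)"
  by (simp_all add: xor_list_def)

lemma nim_move_Cons_iff: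
  "nim_move (y # ys) zs \<longleftrightarrow>
    (\<exists>y'<y. zs = y' # ys) \<or> (\<exists>ys'. nim_move ys ys' \<and> zs = y # ys')"
  by (auto simp: nim_move_def Ex_less_Suc2)

lemma xor_nat_left_cancel:
  "Bit_Operations.xor a b = Bit_Operations.xor a c \<longleftrightarrow> b = c" for a b c :: nat
  by (metis xor.assoc xor_self_eq xor.left_neutral)

lemma xor_nat_right_cancel:
  "Bit_Operations.xor b a = Bit_Operations.xor c a \<longleftrightarrow> b = c" for a b c :: nat
  by (metis xor.commute xor_nat_left_cancel)

lemma nim_move_xor_list_neq: "nim_move ys zs \<Longrightarrow> xor_list zs \<noteq> xor_list ys"
proof (induction ys arbitrary: zs)
  case Nil
  then show ?case by (simp add: nim_move_def)
next
  case (Cons y ys)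
  then show ?case
    by (auto simp: nim_move_Cons_iff xor_list_simps xor_nat_left_cancel xor_nat_right_cancel)
qed

text \<open>
  The list \<open>y # ys\<close> is treated as two heaps of sizes \<open>y\<close> and \<open>xor_list ys\<close>: decreasing the second
  to a prescribed xor is what the induction hypothesis provides.
\<close>

lemma less_xor_list_imp_nim_move:
  assumes "m < xor_list ys"
  shows "\<exists>zs. nim_move ys zs \<and> xor_list zs = m"
  using assms
proof (induction ys arbitrary: m)
  case Nil
  then show ?case by (simp add: xor_list_simps)
next
  case (Cons y ys)
  then have "m < Bit_Operations.xor y (xor_list ys)"
    by (simp add: xor_list_simps)
  then consider "Bit_Operations.xor m (xor_list ys) < y"
    | "Bit_Operations.xor m y < xor_list ys"
    using less_xor_nat_cases by blast
  then show ?case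
  proof cases
    case 1
    then have "nim_move (y # ys) (Bit_Operations.xor m (xor_list ys) # ys)"
      by (simp add: nim_move_Cons_iff)
    then show ?thesis
      by (intro exI conjI) (auto simp: xor_list_simps xor.assoc)
  next
    case 2
    then obtain ys' where "nim_move ys ys'" "xor_list ys' = Bit_Operations.xor m y"
      using Cons.IH by blast
    then have "nim_move (y # ys) (y # ys')" "xor_list (y # ys') = m"
      by (auto simp: nim_move_Cons_iff xor_list_simps xor.left_commute)
    then show ?thesis by blast
  qed
qed

lemma aux_nim_move_0_Cons_iff:
  "aux_nim_move (0 # ys) zs \<longleftrightarrow> (\<exists>ys'. nim_move ys ys' \<and> zs = 0 # ys')"
  by (auto elim: aux_nim_move.cases intro: aux_nim_move.intros)

lemma grundy_0_Cons: "grundy (0 # ys) = xor_list ys"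
proof (induction ys rule: measure_induct_rule[of sum_list])
  case (less ys)
  then have IH: "grundy (0 # ys') = xor_list ys'" if "nim_move ys ys'" for ys'
    using that by (simp add: nim_move_sum_list_less)
  have "grundy (0 # ys) \<le> xor_list ys"
    by (rule grundy_le) (auto simp: aux_nim_move_0_Cons_iff IH dest: nim_move_xor_list_neq)
  moreover have "\<not> grundy (0 # ys) < xor_list ys"
  proof
    assume "grundy (0 # ys) < xor_list ys"
    then obtain ys' where "nim_move ys ys'" "xor_list ys' = grundy (0 # ys)"
      using less_xor_list_imp_nim_move by blast
    then show False
      using IH grundy_option_neq[of "0 # ys" "0 # ys'"] by (simp add: aux_nim_move_0_Cons_iff)
  qed
  ultimately show ?case by simp
qed

theorem corollary2:
  fixes xs :: "nat list"
  assumes "length xs \<ge> 2"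
  shows "hd xs + xor_list (tl xs) \<le> grundy xs \<and> grundy xs \<le> sum_list xs"
proof -
  obtain x ys where "xs = x # ys"
    using assms by (cases xs) auto
  then show ?thesis
    using grundy_Cons_ge[of x ys] grundy_le_sum_list[of xs] by (simp add: grundy_0_Cons)
qed

end
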